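(* Let $n\ge1$ and let $A$ be a nonempty subset of $\{0,1\}^n$. Then $$|\partial^* A|\ \ge\ 4n\left(\frac12-\sqrt{H^{-1}\!\left(\frac{\log|A|}{n}\right)\left(1-H^{-1}\!\left(\frac{\log|A|}{n}\right)\right)}\right)\cdot\frac{|A|}{2^n}.$$
   Context: $\{0,1\}^n$ is the Hamming cube: vertices are binary strings of length $n$, and $x\sim y$ means $x,y$ differ in exactly one coordinate. $\mathbb{E}$, $\mathbb{E}_x$ denote expectation with respect to the uniform probability measure on $\{0,1\}^n$. The fractional edge boundary size of $A\subseteq\{0,1\}^n$ is $$|\partial^*A|=\min\left\{\mathbb{E}_x\sum_{y\sim x}(f(x)-f(y))^2:\ f:\{0,1\}^n\to\mathbb{R},\ \mathrm{supp}(f)\subseteq A,\ \mathbb{E} f^2=\frac{|A|}{2^n}\right\}.$$ All logarithms are natural. $H(x)=-x\log x-(1-x)\log(1-x)$, and $H^{-1}$ denotes the inverse of $H$ restricted to $[0,1/2]$, mapping $[0,\log 2]$ onto $[0,1/2]$. *)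

theory Defs
  imports "HOL-Probability.Probability" "HOL-Real_Asymp.Real_Asymp"
begin

definition cube :: "nat \<Rightarrow> bool list set" where
  "cube n = {x. length x = n}"

definition adj :: "bool list \<Rightarrow> bool list \<Rightarrow> bool" where
  "adj x y \<longleftrightarrow> length x = length y \<and> card {i. i < length x \<and> x ! i \<noteq> y ! i} = 1"

abbreviation cube_expectation :: "nat \<Rightarrow> (bool list \<Rightarrow> real) \<Rightarrow> real" where
  "cube_expectation n g \<equiv> measure_pmf.expectation (pmf_of_set (cube n)) g"

definition dirichlet_energy :: "nat \<Rightarrow> (bool list \<Rightarrow> real) \<Rightarrow> real" where
  "dirichlet_energy n f =
     cube_expectation n (\<lambda>x. \<Sum>y | y \<in> cube n \<and> adj x y. (f x - f y)\<^sup>2)"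

(* The values of a test function outside cube n are irrelevant: they enter neither the
   constraints nor the energy. *)
definition admissible :: "nat \<Rightarrow> bool list set \<Rightarrow> (bool list \<Rightarrow> real) set" where
  "admissible n A =
     {f. {x \<in> cube n. f x \<noteq> 0} \<subseteq> A \<and>
         cube_expectation n (\<lambda>x. (f x)\<^sup>2) = real (card A) / 2 ^ n}"

(* The minimum is over an infinite set of reals; frac_edge_boundary_attained and
   frac_edge_boundary_le below show that it exists. *)
definition frac_edge_boundary :: "nat \<Rightarrow> bool list set \<Rightarrow> real" where
  "frac_edge_boundary n A = (LEAST v. v \<in> dirichlet_energy n ` admissible n A)"

(* Since ln 0 = 0, the convention 0 log 0 = 0 holds automatically. *)
definition bin_entropy :: "real \<Rightarrow> real" where
  "bin_entropy x = - x * ln x - (1 - x) * ln (1 - x)"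

definition bin_entropy_inv :: "real \<Rightarrow> real" where
  "bin_entropy_inv = the_inv_into {0..1/2} bin_entropy"

lemma finite_cube [simp]: "finite (cube n)"
  using finite_lists_length_eq[of "UNIV :: bool set" n] by (simp add: cube_def)

lemma card_cube [simp]: "card (cube n) = 2 ^ n"
  using card_lists_length_eq[of "UNIV :: bool set" n] by (simp add: cube_def)

lemma cube_nonempty [simp]: "cube n \<noteq> {}"
  by (metis card.empty card_cube power_not_zero zero_neq_numeral)

lemma cube_expectation_eq: "cube_expectation n g = (\<Sum>x\<in>cube n. g x) / 2 ^ n"
  by (subst integral_pmf_of_set) auto

lemma frac_edge_boundary_minimum:
  assumes A: "A \<subseteq> cube n"
  shows "\<exists>f\<in>admissible n A. \<forall>g\<in>admissible n A. dirichlet_energy n f \<le> dirichlet_energy n g"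
proof -
  define c where "c = sqrt (real (card A))"
  define B where "B = (\<lambda>x. if x \<in> A then {-c..c} else {0})"
  define N where "N = (\<lambda>f::bool list \<Rightarrow> real. \<Sum>x\<in>cube n. (f x)\<^sup>2)"
  define K where "K = PiE UNIV B \<inter> N -` {real (card A)}"
  have finA: "finite A" using A finite_cube by (rule finite_subset)
  have coord: "continuous_on S (\<lambda>f::bool list \<Rightarrow> real. f x)" for x S
    by (rule continuous_on_subset[OF continuous_on_product_coordinates]) simp
  have cN: "continuous_on UNIV N"
    unfolding N_def by (intro continuous_intros coord)
  have "compactin euclidean (PiE UNIV B)"
    unfolding euclidean_product_topology[symmetric] compactin_PiE by (auto simp: B_def)
  hence "compact (PiE UNIV B)" by simp
  moreover have "closed (N -` {real (card A)})"
    by (rule closed_vimage[OF _ cN]) simp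
  ultimately have K: "compact K" unfolding K_def by (rule compact_Int_closed)
  have cE: "continuous_on K (dirichlet_energy n)"
    unfolding dirichlet_energy_def[abs_def] cube_expectation_eq
    by (intro continuous_intros coord) auto
  have adm: "f \<in> admissible n A \<longleftrightarrow> (\<forall>x\<in>cube n. f x \<noteq> 0 \<longrightarrow> x \<in> A) \<and> N f = card A" for f
    unfolding admissible_def cube_expectation_eq N_def by auto
  have red: "\<exists>h\<in>K. dirichlet_energy n h = dirichlet_energy n f" if f: "f \<in> admissible n A" for f
  proof
    define h where "h = (\<lambda>x. if x \<in> A then f x else 0)"
    have eq: "h x = f x" if "x \<in> cube n" for x
      using f that unfolding adm h_def by auto
    have "N h = N f" unfolding N_def by (intro sum.cong) (auto simp: eq)
    hence Nh: "N h = card A" using f adm by simp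
    have "\<bar>f x\<bar> \<le> c" if "x \<in> A" for x
    proof -
      have "(f x)\<^sup>2 \<le> N f" unfolding N_def
        using A that by (intro member_le_sum) auto
      hence "(f x)\<^sup>2 \<le> card A" using f adm by simp
      thus ?thesis unfolding c_def by (metis real_sqrt_abs real_sqrt_le_mono)
    qed
    hence "h \<in> PiE UNIV B" unfolding B_def h_def by (auto simp: abs_le_iff) (smt (verit))+
    thus "h \<in> K" using Nh unfolding K_def by simp
    show "dirichlet_energy n h = dirichlet_energy n f"
      unfolding dirichlet_energy_def cube_expectation_eq
      by (intro arg_cong2[where f="(/)"] refl sum.cong) (auto simp: eq)
  qed
  have sub: "f \<in> admissible n A" if "f \<in> K" for f
  proof -
    have "f x \<in> B x" for x using that unfolding K_def by auto
    thus ?thesis using that unfolding adm K_def B_def by (auto split: if_splits) (meson singletonD)+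
  qed
  have "(\<lambda>x. if x \<in> A then 1 else 0) \<in> admissible n A"
    using A by (auto simp: adm N_def if_distrib[of "\<lambda>t. t^2"] sum.If_cases inf_absorb2 cong: if_cong)
  hence "K \<noteq> {}" using red by blast
  from continuous_attains_inf[OF K this cE] show ?thesis using red sub by metis
qed

lemma frac_edge_boundary_least:
  assumes "A \<subseteq> cube n"
  shows "frac_edge_boundary n A \<in> dirichlet_energy n ` admissible n A \<and>
         (\<forall>f\<in>admissible n A. frac_edge_boundary n A \<le> dirichlet_energy n f)"
proof -
  obtain f where f: "f \<in> admissible n A"
    "\<And>g. g \<in> admissible n A \<Longrightarrow> dirichlet_energy n f \<le> dirichlet_energy n g"
    using frac_edge_boundary_minimum[OF assms] by blast
  have "frac_edge_boundary n A = dirichlet_energy n f"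
    unfolding frac_edge_boundary_def by (rule Least_equality) (use f in auto)
  thus ?thesis using f by auto
qed

lemma frac_edge_boundary_attained:
  "A \<subseteq> cube n \<Longrightarrow> frac_edge_boundary n A \<in> dirichlet_energy n ` admissible n A"
  using frac_edge_boundary_least by blast

lemma frac_edge_boundary_le:
  "A \<subseteq> cube n \<Longrightarrow> f \<in> admissible n A \<Longrightarrow> frac_edge_boundary n A \<le> dirichlet_energy n f"
  using frac_edge_boundary_least by blast

lemma continuous_on_bin_entropy: "continuous_on {0..1/2} bin_entropy"
  unfolding continuous_on_def
proof
  fix x :: real assume x: "x \<in> {0..1/2}"
  show "(bin_entropy \<longlongrightarrow> bin_entropy x) (at x within {0..1/2})"
  proof (cases "x = 0")
    case True
    have "(bin_entropy \<longlongrightarrow> 0) (at_right 0)"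
      unfolding bin_entropy_def[abs_def] by real_asymp
    moreover have "at (0::real) within {0..1/2} = at_right 0"
      by (rule at_within_Icc_at_right) simp
    ultimately show ?thesis using True by (simp add: bin_entropy_def)
  next
    case False
    then show ?thesis using x unfolding bin_entropy_def[abs_def]
      by (intro tendsto_intros) auto
  qed
qed

lemma bin_entropy_strict_mono: "strict_mono_on {0..1/2} bin_entropy"
proof (rule strict_mono_onI)
  fix a b :: real assume ab: "a \<in> {0..1/2}" "b \<in> {0..1/2}" "a < b"
  show "bin_entropy a < bin_entropy b"
  proof (rule DERIV_pos_imp_increasing_open[OF ab(3)])
    fix x assume x: "a < x" "x < b"
    have "(bin_entropy has_real_derivative (ln (1 - x) - ln x)) (at x)"
      unfolding bin_entropy_def[abs_def] using x ab
      by (auto intro!: derivative_eq_intros simp: minus_divide_left[symmetric])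
    moreover have "ln (1 - x) - ln x > 0" using x ab by simp
    ultimately show "\<exists>y. (bin_entropy has_real_derivative y) (at x) \<and> y > 0" by blast
  next
    show "continuous_on {a..b} bin_entropy"
      by (rule continuous_on_subset[OF continuous_on_bin_entropy]) (use ab in auto)
  qed
qed

lemma bij_betw_bin_entropy: "bij_betw bin_entropy {0..1/2} {0..ln 2}"
proof -
  have e0: "bin_entropy 0 = 0" and e1: "bin_entropy (1/2) = ln 2"
    by (simp_all add: bin_entropy_def ln_div)
  have "bin_entropy ` {0..1/2} = {0..ln 2}"
  proof (intro equalityI subsetI)
    fix y assume "y \<in> bin_entropy ` {0..1/2}"
    then obtain x where x: "x \<in> {0..1/2}" "y = bin_entropy x" by auto
    have "bin_entropy 0 \<le> bin_entropy x" "bin_entropy x \<le> bin_entropy (1/2)"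
      using strict_mono_on_leD[OF bin_entropy_strict_mono] x by auto
    thus "y \<in> {0..ln 2}" using x e0 e1 by simp
  next
    fix y :: real assume "y \<in> {0..ln 2}"
    hence "\<exists>x. 0 \<le> x \<and> x \<le> 1/2 \<and> bin_entropy x = y"
      by (intro IVT') (auto simp: e0 e1 continuous_on_bin_entropy)
    thus "y \<in> bin_entropy ` {0..1/2}" by auto
  qed
  thus ?thesis
    using strict_mono_on_imp_inj_on[OF bin_entropy_strict_mono] by (simp add: bij_betw_def)
qed

end

theory Submission
  imports Defs
begin

text \<open>
  Fix \<open>h \<in> (0, 1/2)\<close>. On \<open>[0, 1/2]\<close> the function \<open>2 sqrt (q (1 - q))\<close> is a concave function of the
  entropy \<open>H q\<close>: after substituting \<open>(1 - q) / q = exp (2 t)\<close> the slope becomes \<open>sinh t / t\<close>. Its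
  tangent at \<open>h\<close> is a two-point logarithmic Sobolev inequality, which tensorizes over the
  coordinates of the cube by Cauchy--Schwarz and the chain rule for entropy. For \<open>f\<close> supported on
  \<open>A\<close> the entropy of \<open>f\<^sup>2\<close> is at most \<open>log |A|\<close>, and letting \<open>h\<close> decrease to
  \<open>H\<^sup>-\<^sup>1 (log |A| / n)\<close> gives the bound. The limit also covers \<open>|A| = 1\<close>, where the tangent is
  vertical.
\<close>

section \<open>The two-point inequality from concavity in the entropy\<close>

lemma sinh_over_self_strict_mono:
  fixes s t :: real
  assumes "0 < s" "s < t"
  shows "sinh s / s < sinh t / t"
proof (rule DERIV_pos_imp_increasing[OF assms(2)])
  fix x assume x: "s \<le> x" "x \<le> t"
  hence x0: "x > 0" using assms by simp
  \<comment> \<open>The numerator of the derivative of \<open>sinh x / x\<close> vanishes at 0 and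
    has derivative \<open>y * sinh y\<close>, so it is positive.\<close>
  have "(\<lambda>x. x * cosh x - sinh x) 0 < (\<lambda>x. x * cosh x - sinh x) x"
  proof (rule DERIV_pos_imp_increasing_open[OF x0])
    fix y :: real assume y: "0 < y" "y < x"
    have "((\<lambda>x. x * cosh x - sinh x) has_real_derivative y * sinh y) (at y)"
      by (auto intro!: derivative_eq_intros)
    thus "\<exists>d. ((\<lambda>x. x * cosh x - sinh x) has_real_derivative d) (at y) \<and> 0 < d"
      using y by auto
  qed (intro continuous_intros)
  hence pos: "0 < (x * cosh x - sinh x) / x\<^sup>2" using x0 by simp
  have "((\<lambda>x. sinh x / x) has_real_derivative (x * cosh x - sinh x) / x\<^sup>2) (at x)"
    using x0 by (auto intro!: derivative_eq_intros simp: power2_eq_square mult.commute)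
  thus "\<exists>d. ((\<lambda>x. sinh x / x) has_real_derivative d) (at x) \<and> 0 < d" using pos by blast
qed

text \<open>The derivative of \<open>2 * sqrt (q * (1 - q))\<close> with respect to the entropy: its
  \<open>q\<close>-derivative divided by that of \<open>bin_entropy\<close>.\<close>

definition tangent_slope :: "real \<Rightarrow> real" where
  "tangent_slope q = (1 - 2 * q) / (sqrt (q * (1 - q)) * (ln (1 - q) - ln q))"

lemma tangent_slope_eq_sinh:
  assumes "0 < q" "q < 1 / 2"
  defines "t \<equiv> (ln (1 - q) - ln q) / 2"
  shows "tangent_slope q = sinh t / t"
proof -
  define u v where "u = sqrt q" and "v = sqrt (1 - q)"
  have uv: "u > 0" "v > 0" "u * u = q" "v * v = 1 - q"
    using assms by (simp_all add: u_def v_def)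
  have "t = ln (v / u)"
    using assms uv by (simp add: t_def u_def v_def ln_div ln_sqrt diff_divide_distrib)
  hence "exp t = v / u" "exp (- t) = u / v"
    using uv by (simp_all add: exp_minus)
  hence "sinh t = (v / u - u / v) / 2" by (simp add: sinh_field_def)
  also have "\<dots> = (1 - 2 * q) / (2 * (u * v))"
    using uv by (simp add: field_simps)
  also have "u * v = sqrt (q * (1 - q))" by (simp add: u_def v_def real_sqrt_mult)
  finally have "sinh t = (1 - 2 * q) / (2 * sqrt (q * (1 - q)))" .
  hence "sinh t / t = (1 - 2 * q) / (sqrt (q * (1 - q)) * (2 * t))"
    by (simp only: divide_divide_eq_left mult_ac)
  moreover have "2 * t = ln (1 - q) - ln q" by (simp add: t_def)
  ultimately show ?thesis by (simp only: tangent_slope_def)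
qed

text \<open>As \<open>q\<close> grows towards 1/2, the parameter \<open>t\<close> falls and
  \<open>sinh t / t\<close> falls with it; this is the concavity.\<close>

lemma tangent_slope_strict_antimono:
  assumes "0 < p" "p < q" "q < 1 / 2"
  shows "tangent_slope q < tangent_slope p"
proof -
  have "ln p < ln q" "ln (1 - q) < ln (1 - p)" "ln q < ln (1 - q)"
    using assms by auto
  hence "sinh ((ln (1 - q) - ln q) / 2) / ((ln (1 - q) - ln q) / 2) <
         sinh ((ln (1 - p) - ln p) / 2) / ((ln (1 - p) - ln p) / 2)"
    by (intro sinh_over_self_strict_mono) auto
  thus ?thesis using assms by (simp only: tangent_slope_eq_sinh)
qed

lemma tangent_slope_pos: "0 < q \<Longrightarrow> q < 1 / 2 \<Longrightarrow> 0 < tangent_slope q"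
  unfolding tangent_slope_def by (intro divide_pos_pos mult_pos_pos) auto

text \<open>The difference \<open>G\<close> has a derivative with the sign of
  \<open>tangent_slope h - tangent_slope x\<close>, which changes from negative to positive at
  \<open>h\<close>, so \<open>G\<close> is smallest there. Continuity covers the endpoints 0 and
  1/2.\<close>

lemma two_point_tangent:
  assumes h: "0 < h" "h < 1 / 2" and q: "0 \<le> q" "q \<le> 1 / 2"
  shows "2 * sqrt (q * (1 - q)) - 2 * sqrt (h * (1 - h)) \<le>
         tangent_slope h * (bin_entropy q - bin_entropy h)"
proof -
  define G where "G = (\<lambda>q. tangent_slope h * bin_entropy q - 2 * sqrt (q * (1 - q)))"
  have deriv: "(G has_real_derivative
                 (ln (1 - x) - ln x) * (tangent_slope h - tangent_slope x)) (at x)"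
    if x: "0 < x" "x < 1 / 2" for x
  proof -
    have H: "(bin_entropy has_real_derivative (ln (1 - x) - ln x)) (at x)"
      unfolding bin_entropy_def[abs_def] using x
      by (auto intro!: derivative_eq_intros simp: minus_divide_left[symmetric])
    have pos: "x * (1 - x) > 0" "ln (1 - x) - ln x > 0" using x by auto
    have "((\<lambda>x. sqrt (x * (1 - x))) has_real_derivative
             (1 - 2 * x) / (2 * sqrt (x * (1 - x)))) (at x)"
      using x pos(1) by (auto intro!: derivative_eq_intros simp: field_simps)
    hence "(G has_real_derivative
             tangent_slope h * (ln (1 - x) - ln x)
             - 2 * ((1 - 2 * x) / (2 * sqrt (x * (1 - x))))) (at x)"
      unfolding G_def by (intro DERIV_diff DERIV_cmult H)
    also have "2 * ((1 - 2 * x) / (2 * sqrt (x * (1 - x)))) =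
               (ln (1 - x) - ln x) * tangent_slope x"
    proof -
      have "2 * (k / (2 * w)) = L * (k / (w * L))" if "L > 0" for k w L :: real
        using that by simp
      from this[OF pos(2)] show ?thesis unfolding tangent_slope_def .
    qed
    finally show ?thesis by (simp add: algebra_simps)
  qed
  have cont: "continuous_on {0..1/2} G"
    unfolding G_def by (intro continuous_intros continuous_on_bin_entropy)
  have "G h \<le> G q"
  proof (cases q h rule: linorder_cases)
    case less
    have "G h < G q"
    proof (rule DERIV_neg_imp_decreasing_open[OF less])
      fix x assume x: "q < x" "x < h"
      hence "(ln (1 - x) - ln x) * (tangent_slope h - tangent_slope x) < 0"
        using h q tangent_slope_strict_antimono[of x h] by (intro mult_pos_neg) auto
      thus "\<exists>d. (G has_real_derivative d) (at x) \<and> d < 0"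
        using deriv[of x] x h q by auto
    qed (rule continuous_on_subset[OF cont], use h q in auto)
    thus ?thesis by simp
  next
    case greater
    have "G h < G q"
    proof (rule DERIV_pos_imp_increasing_open[OF greater])
      fix x assume x: "h < x" "x < q"
      hence "(ln (1 - x) - ln x) * (tangent_slope h - tangent_slope x) > 0"
        using h q tangent_slope_strict_antimono[of h x] by (intro mult_pos_pos) auto
      thus "\<exists>d. (G has_real_derivative d) (at x) \<and> d > 0"
        using deriv[of x] x h q by auto
    qed (rule continuous_on_subset[OF cont], use h q in auto)
    thus ?thesis by simp
  qed simp
  thus ?thesis by (simp add: G_def algebra_simps)
qed

text \<open>The intercept at entropy 0 of the tangent line at \<open>h\<close>.\<close>

definition tangent_const :: "real \<Rightarrow> real" where
  "tangent_const h = 2 * sqrt (h * (1 - h)) - tangent_slope h * bin_entropy h"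

text \<open>The tangent inequality at \<open>q = s / (s + t)\<close>, multiplied by
  \<open>s + t\<close>. Both sides are symmetric, so \<open>s \<le> t\<close> may be assumed, which
  puts \<open>q\<close> in \<open>[0, 1/2]\<close>.\<close>

lemma two_point_log_sobolev:
  assumes h: "0 < h" "h < 1 / 2" and st: "0 \<le> s" "0 \<le> t"
  shows "2 * sqrt (s * t) \<le> tangent_const h * (s + t) +
           tangent_slope h * ((s + t) * ln (s + t) - s * ln s - t * ln t)"
  using st
proof (induction s t rule: linorder_wlog)
  case (sym s t)
  thus ?case by (simp add: mult.commute add.commute algebra_simps)
next
  case (le s t)
  show ?case
  proof (cases "s = 0")
    case True
    \<comment> \<open>This case includes \<open>s + t = 0\<close>. The entropy term vanishes, so a
      nonnegative intercept suffices; that is the tangent inequality at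
      \<open>q = 0\<close>.\<close>
    have "bin_entropy 0 = 0" by (simp add: bin_entropy_def)
    hence "0 \<le> tangent_const h"
      using two_point_tangent[OF h, of 0] by (simp add: tangent_const_def)
    thus ?thesis using True le by simp
  next
    case False
    define q where "q = s / (s + t)"
    have pos: "s > 0" "t > 0" "s + t > 0" using False le by auto
    have q: "0 \<le> q" "q \<le> 1 / 2" "1 - q = t / (s + t)"
      using pos le by (auto simp: q_def field_simps)
    have "q * (1 - q) = s * t / (s + t)\<^sup>2" unfolding q(3) by (simp add: q_def power2_eq_square)
    hence sq: "(s + t) * sqrt (q * (1 - q)) = sqrt (s * t)"
      using pos by (simp add: real_sqrt_divide)
    have ent: "(s + t) * bin_entropy q = (s + t) * ln (s + t) - s * ln s - t * ln t"
    proof -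
      have "bin_entropy q = - (s / (s + t)) * (ln s - ln (s + t)) - t / (s + t) * (ln t - ln (s + t))"
        unfolding bin_entropy_def q(3) using pos by (simp add: q_def ln_div)
      also have "(s + t) * \<dots> = - s * (ln s - ln (s + t)) - t * (ln t - ln (s + t))"
        using pos by (simp add: right_diff_distrib)
      finally show ?thesis by (simp add: algebra_simps)
    qed
    have "2 * sqrt (q * (1 - q)) \<le> tangent_const h + tangent_slope h * bin_entropy q"
      using two_point_tangent[OF h q(1,2)] by (simp add: tangent_const_def algebra_simps)
    hence "(s + t) * (2 * sqrt (q * (1 - q))) \<le>
           (s + t) * (tangent_const h + tangent_slope h * bin_entropy q)"
      using pos by (intro mult_left_mono) auto
    also have "\<dots> = tangent_const h * (s + t) + tangent_slope h * ((s + t) * bin_entropy q)"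
      by (simp add: algebra_simps)
    finally show ?thesis using sq ent by (simp add: mult.left_commute)
  qed
qed

section \<open>Tensorization over the coordinates of the cube\<close>

lemma cube_0: "cube 0 = {[]}"
  by (auto simp: cube_def)

lemma sum_cube_Suc:
  "(\<Sum>x\<in>cube (Suc n). g x) = (\<Sum>x\<in>cube n. g (True # x)) + (\<Sum>x\<in>cube n. g (False # x))"
proof -
  have eq: "cube (Suc n) = Cons True ` cube n \<union> Cons False ` cube n"
    by (auto simp: cube_def length_Suc_conv image_iff)
  show ?thesis
    unfolding eq by (subst sum.union_disjoint) (auto simp: sum.reindex)
qed

lemma adj_Cons:
  "adj (b # x) (c # y) \<longleftrightarrow> (if b = c then adj x y else x = y)"
proof (cases "length x = length y")
  case True
  define D where "D = {i. i < length x \<and> x ! i \<noteq> y ! i}"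
  define D' where "D' = {i. i < length (b # x) \<and> (b # x) ! i \<noteq> (c # y) ! i}"
  have "i \<in> D' \<longleftrightarrow> i \<in> (if b = c then {} else {0}) \<union> Suc ` D" for i
    by (cases i) (auto simp: D_def D'_def)
  hence D': "D' = (if b = c then {} else {0}) \<union> Suc ` D" by blast
  have fin: "finite D" by (simp add: D_def)
  have "card D' = (if b = c then card D else Suc (card D))"
    using fin by (simp add: D' card_image card_insert_if image_iff)
  moreover have "D = {} \<longleftrightarrow> x = y"
    using True by (auto simp: D_def list_eq_iff_nth_eq)
  moreover have "adj x y \<longleftrightarrow> card D = 1" "adj (b # x) (c # y) \<longleftrightarrow> card D' = 1"
    using True by (simp_all add: adj_def D_def D'_def)
  ultimately show ?thesis using fin by simp
qed (auto simp: adj_def)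

text \<open>Left unnormalized so that the recursion in \<open>n\<close> carries no powers of 2; each
  edge is counted in both directions.\<close>

definition energy_sum :: "nat \<Rightarrow> (bool list \<Rightarrow> real) \<Rightarrow> real" where
  "energy_sum n f = (\<Sum>x\<in>cube n. \<Sum>y | y \<in> cube n \<and> adj x y. (f x - f y)\<^sup>2)"

lemma energy_sum_altdef:
  "energy_sum n f = (\<Sum>x\<in>cube n. \<Sum>y\<in>cube n. if adj x y then (f x - f y)\<^sup>2 else 0)"
  unfolding energy_sum_def by (intro sum.cong refl sum.mono_neutral_cong_left) auto

lemma energy_sum_nonneg: "0 \<le> energy_sum n f"
  unfolding energy_sum_def by (intro sum_nonneg) auto

text \<open>An edge lies in one of the two half cubes or joins them; the joining edges occur in both
  orders, hence the factor 2.\<close>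

lemma energy_sum_Suc:
  "energy_sum (Suc n) f =
     energy_sum n (\<lambda>x. f (True # x)) + energy_sum n (\<lambda>x. f (False # x)) +
     2 * (\<Sum>x\<in>cube n. (f (True # x) - f (False # x))\<^sup>2)"
  by (simp add: energy_sum_altdef sum_cube_Suc adj_Cons sum.distrib
      power2_commute[of "f (False # x)" "f (True # y)" for x y])

text \<open>For nonnegative \<open>g\<close> of total mass \<open>S > 0\<close> this is
  \<open>S\<close> times the Shannon entropy of \<open>g / S\<close>.\<close>

definition entropy_sum :: "nat \<Rightarrow> (bool list \<Rightarrow> real) \<Rightarrow> real" where
  "entropy_sum n g =
     (\<Sum>x\<in>cube n. g x) * ln (\<Sum>x\<in>cube n. g x) - (\<Sum>x\<in>cube n. g x * ln (g x))"

text \<open>Induction on the first coordinate: the edges joining the halves contribute at least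
  \<open>(2 - 2 * a) * (s + t) - 2 * l * e\<close>, where \<open>s\<close>, \<open>t\<close> are the
  masses of the halves.\<close>

lemma cube_log_sobolev:
  assumes h: "0 < h" "h < 1 / 2"
  shows "energy_sum n f \<ge> real n * (2 - 2 * tangent_const h) * (\<Sum>x\<in>cube n. (f x)\<^sup>2)
           - 2 * tangent_slope h * entropy_sum n (\<lambda>x. (f x)\<^sup>2)"
proof (induction n arbitrary: f)
  case 0
  show ?case by (simp add: energy_sum_altdef entropy_sum_def cube_0 adj_def)
next
  case (Suc n)
  define f0 f1 where "f0 = (\<lambda>x. f (True # x))" and "f1 = (\<lambda>x. f (False # x))"
  define s t where "s = (\<Sum>x\<in>cube n. (f0 x)\<^sup>2)" and "t = (\<Sum>x\<in>cube n. (f1 x)\<^sup>2)"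
  define a l where "a = tangent_const h" and "l = tangent_slope h"
  define P D where "P = (\<Sum>x\<in>cube n. f0 x * f1 x)" and "D = (\<Sum>x\<in>cube n. (f0 x - f1 x)\<^sup>2)"
  define e where "e = (s + t) * ln (s + t) - s * ln s - t * ln t"
  have st: "0 \<le> s" "0 \<le> t" by (simp_all add: s_def t_def sum_nonneg)
  \<comment> \<open>Chain rule: the entropies of the halves plus the entropy \<open>e\<close> of the
    split of mass between them.\<close>
  have ent: "entropy_sum (Suc n) (\<lambda>x. (f x)\<^sup>2) =
      entropy_sum n (\<lambda>x. (f0 x)\<^sup>2) + entropy_sum n (\<lambda>x. (f1 x)\<^sup>2) + e"
    by (simp add: entropy_sum_def sum_cube_Suc f0_def f1_def s_def t_def e_def)
  \<comment> \<open>Cauchy-Schwarz reduces the cross term to the two masses, where the two-point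
    inequality applies.\<close>
  have "P\<^sup>2 \<le> s * t"
    unfolding P_def s_def t_def by (rule Cauchy_Schwarz_ineq_sum)
  hence "2 * P \<le> 2 * sqrt (s * t)" by (simp add: real_le_rsqrt)
  also have "\<dots> \<le> a * (s + t) + l * e"
    unfolding a_def l_def e_def by (rule two_point_log_sobolev[OF h st])
  finally have "2 * P \<le> a * (s + t) + l * e" .
  moreover have "D = s + t - 2 * P"
    by (simp add: D_def P_def s_def t_def power2_diff sum.distrib sum_subtractf sum_distrib_left mult.assoc)
  ultimately have "2 * D \<ge> 2 * (s + t) - 2 * (a * (s + t) + l * e)"
    by argo
  moreover have "energy_sum n f0 \<ge> real n * (2 - 2 * a) * s
      - 2 * l * entropy_sum n (\<lambda>x. (f0 x)\<^sup>2)"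
    unfolding s_def a_def l_def by (rule Suc.IH)
  moreover have "energy_sum n f1 \<ge> real n * (2 - 2 * a) * t
      - 2 * l * entropy_sum n (\<lambda>x. (f1 x)\<^sup>2)"
    unfolding t_def a_def l_def by (rule Suc.IH)
  moreover have "energy_sum (Suc n) f = energy_sum n f0 + energy_sum n f1 + 2 * D"
    unfolding D_def f0_def f1_def by (rule energy_sum_Suc)
  moreover have "(\<Sum>x\<in>cube (Suc n). (f x)\<^sup>2) = s + t"
    by (simp add: sum_cube_Suc s_def t_def f0_def f1_def)
  ultimately show ?case
    unfolding ent a_def[symmetric] l_def[symmetric] by (simp add: algebra_simps)
qed

section \<open>The entropy bound from the support, and the limit in \<open>h\<close>\<close>

lemma entropy_sum_le_ln_card:
  assumes A: "A \<subseteq> cube n" and g: "\<And>x. 0 \<le> g x"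
    and supp: "{x \<in> cube n. g x \<noteq> 0} \<subseteq> A" and S: "(\<Sum>x\<in>cube n. g x) = real (card A)"
  shows "entropy_sum n g \<le> real (card A) * ln (real (card A))"
proof -
  have fin: "finite A" using A by (rule finite_subset) simp
  have "(\<Sum>x\<in>cube n. g x - g x * ln (g x)) = (\<Sum>x\<in>A. g x - g x * ln (g x))"
    using A supp by (intro sum.mono_neutral_right) auto
  \<comment> \<open>The pointwise bound is \<open>ln u \<le> u - 1\<close> at
    \<open>u = 1 / g x\<close>. As the mass of \<open>g\<close> equals \<open>card A\<close>,
    summing it leaves \<open>g * ln g\<close> with nonnegative total.\<close>
  also have "\<dots> \<le> (\<Sum>x\<in>A. 1)"
  proof (rule sum_mono)
    fix x
    show "g x - g x * ln (g x) \<le> 1"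
    proof (cases "g x = 0")
      case False
      hence pos: "g x > 0" using g[of x] by simp
      have "ln (inverse (g x)) \<le> inverse (g x) - 1" using pos by (intro ln_le_minus_one) simp
      hence "g x * (- ln (g x)) \<le> g x * (inverse (g x) - 1)"
        using pos by (intro mult_left_mono) (auto simp: ln_inverse)
      thus ?thesis using pos by (simp add: algebra_simps)
    qed simp
  qed
  finally have "(\<Sum>x\<in>cube n. g x * ln (g x)) \<ge> 0"
    using S by (simp add: sum_subtractf)
  thus ?thesis using S by (simp add: entropy_sum_def)
qed

text \<open>Bounding the entropy by \<open>card A * n * bin_entropy h\<close> cancels the slope term
  inside \<open>tangent_const h\<close>. Only an inequality is asked of \<open>h\<close>, which
  leaves room for a limit.\<close>

lemma energy_sum_ge:
  assumes A: "A \<subseteq> cube n" and supp: "{x \<in> cube n. f x \<noteq> 0} \<subseteq> A"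
    and S: "(\<Sum>x\<in>cube n. (f x)\<^sup>2) = real (card A)"
    and h: "0 < h" "h < 1 / 2" "ln (real (card A)) \<le> real n * bin_entropy h"
  shows "energy_sum n f \<ge> 4 * real n * (1 / 2 - sqrt (h * (1 - h))) * real (card A)"
proof -
  have "entropy_sum n (\<lambda>x. (f x)\<^sup>2) \<le> real (card A) * ln (real (card A))"
    using A supp S by (intro entropy_sum_le_ln_card) auto
  also have "\<dots> \<le> real (card A) * (real n * bin_entropy h)"
    using h by (intro mult_left_mono) auto
  finally have "2 * tangent_slope h * entropy_sum n (\<lambda>x. (f x)\<^sup>2) \<le>
      2 * tangent_slope h * (real (card A) * (real n * bin_entropy h))"
    using tangent_slope_pos[of h] h by (intro mult_left_mono) auto
  thus ?thesis
    using cube_log_sobolev[OF h(1,2), of n f] S by (simp add: tangent_const_def algebra_simps)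
qed

theorem theorem1p4:
  fixes n :: nat and A :: "bool list set"
  assumes "n \<ge> 1" and "A \<subseteq> cube n" and "A \<noteq> {}"
  shows "frac_edge_boundary n A \<ge>
    4 * real n *
      (1 / 2 - sqrt (bin_entropy_inv (ln (real (card A)) / real n) *
                     (1 - bin_entropy_inv (ln (real (card A)) / real n))))
      * (real (card A) / 2 ^ n)"
proof -
  define c where "c = real (card A)"
  define p where "p = bin_entropy_inv (ln c / real n)"
  obtain f where f: "f \<in> admissible n A" "frac_edge_boundary n A = dirichlet_energy n f"
    using frac_edge_boundary_attained[OF assms(2)] by auto
  have supp: "{x \<in> cube n. f x \<noteq> 0} \<subseteq> A" and S: "(\<Sum>x\<in>cube n. (f x)\<^sup>2) = c"
    using f(1) by (auto simp: admissible_def cube_expectation_eq c_def)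
  have E: "frac_edge_boundary n A = energy_sum n f / 2 ^ n"
    using f(2) by (simp add: dirichlet_energy_def cube_expectation_eq energy_sum_def)
  have "finite A" using assms(2) by (rule finite_subset) simp
  hence "card A \<ge> 1" using assms(3) by (simp add: Suc_le_eq card_gt_0_iff)
  hence c1: "c \<ge> 1" by (simp add: c_def)
  have "card A \<le> 2 ^ n" using card_mono[OF finite_cube assms(2)] by simp
  hence "c \<le> 2 ^ n" unfolding c_def by (metis of_nat_le_iff of_nat_numeral of_nat_power)
  hence "ln c \<le> ln (2 ^ n)" using c1 by simp
  hence "ln c \<le> real n * ln 2" by (simp add: ln_realpow)
  \<comment> \<open>From \<open>1 \<le> c \<le> 2 ^ n\<close>; on this interval the inverse entropy
    is a genuine inverse.\<close>
  hence range: "ln c / real n \<in> {0..ln 2}"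
    using c1 assms(1) by (simp add: field_simps)
  have p: "p \<in> {0..1/2}" "bin_entropy p = ln c / real n"
    unfolding p_def bin_entropy_inv_def
    using bij_betwE[OF bij_betw_the_inv_into[OF bij_betw_bin_entropy]] range
      f_the_inv_into_f_bij_betw[OF bij_betw_bin_entropy] by blast+
  have "energy_sum n f \<ge> 4 * real n * (1 / 2 - sqrt (p * (1 - p))) * c"
  proof (cases "p = 1 / 2")
    case True
    \<comment> \<open>No \<open>h\<close> lies strictly between \<open>p\<close> and 1/2 here, but
      the claimed bound is 0.\<close>
    have "sqrt (p * (1 - p)) = 1 / 2" by (rule real_sqrt_unique) (auto simp: True power2_eq_square)
    thus ?thesis using energy_sum_nonneg[of n f] by (simp only:) simp
  next
    case False
    hence p2: "0 \<le> p" "p < 1 / 2" using p by auto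
    \<comment> \<open>The bound is continuous in \<open>h\<close>, and each \<open>h\<close> in
      \<open>(p, 1/2)\<close> qualifies because its entropy exceeds \<open>ln c / n\<close>.\<close>
    have "((\<lambda>h. 4 * real n * (1 / 2 - sqrt (h * (1 - h))) * c) \<longlongrightarrow>
            4 * real n * (1 / 2 - sqrt (p * (1 - p))) * c) (at_right p)"
      by (intro tendsto_intros)
    moreover have "\<forall>\<^sub>F h in at_right p. 4 * real n * (1 / 2 - sqrt (h * (1 - h))) * c \<le> energy_sum n f"
      using eventually_at_right_real[OF p2(2)]
    proof eventually_elim
      case (elim h)
      have "bin_entropy p < bin_entropy h"
        using elim p2 by (intro strict_mono_onD[OF bin_entropy_strict_mono]) auto
      hence "ln c \<le> real n * bin_entropy h"
        using p(2) assms(1) by (simp add: field_simps)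
      thus ?case
        using energy_sum_ge[OF assms(2) supp, of h] S elim p2 by (simp add: c_def)
    qed
    ultimately show ?thesis
      by (intro tendsto_upperbound[where F = "at_right p"]) auto
  qed
  hence "energy_sum n f / 2 ^ n \<ge> 4 * real n * (1 / 2 - sqrt (p * (1 - p))) * c / 2 ^ n"
    by (intro divide_right_mono) auto
  thus ?thesis unfolding E p_def c_def by simp
qed

end
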